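(* Let $\Sigma$ be a strongly stable discrete-time LSS. Then $\Sigma$ is span-reachable if and only if its nice controllability grammian $\mathcal{P}$ is strictly positive definite, and $\Sigma$ is observable if and only if its nice observability grammian $\mathcal{R}$ is strictly positive definite.
   Context: Let $Q=\{1,\ldots,D\}$, $D\ge1$. A discrete-time linear switched system (LSS) is a tuple $\Sigma=(n,Q,\{(A_q,B_q,C_q)\mid q\in Q\})$ with $A_q\in\mathbb{R}^{n\times n}$, $B_q\in\mathbb{R}^{n\times m}$, $C_q\in\mathbb{R}^{p\times n}$. For $x_0\in\mathbb{R}^n$, $u\in\mathcal{U}=l_2(\mathbb{N},\mathbb{R}^m)$ and a switching sequence $q\in\mathcal{Q}$ (infinite sequence in $Q$), let $X^\Sigma_{x_0}(u,q)=x$ and $Y^\Sigma_{x_0}(u,q)=y$ be given by $x(t+1)=A_{q(t)}x(t)+B_{q(t)}u(t)$, $x(0)=x_0$, $y(t)=C_{q(t)}x(t)$. $\Sigma$ is observable if $x_1\ne x_2$ implies $Y^\Sigma_{x_1}\ne Y^\Sigma_{x_2}$ as maps on $\mathcal{U}\times\mathcal{Q}$. $\Sigma$ is span-reachable if the linear span of $\{X^\Sigma_0(u,q)(t)\mid u\in\mathcal{U},q\in\mathcal{Q},t\in\mathbb{N}\}$ is $\mathbb{R}^n$. $\Sigma$ is strongly stable if all eigenvalues of $\sum_{q\in Q}A_q^T\otimes A_q^T$ lie inside the open unit disc. In that case the nice controllability grammian $\mathcal{P}$ and the nice observability grammian $\mathcal{R}$ are the unique positive semi-definite solutions of $$\mathcal{P}=\sum_{q\in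 Q}A_q\mathcal{P}A_q^T+\sum_{q\in Q}B_qB_q^T,\qquad \mathcal{R}=\sum_{q\in Q}A_q^T\mathcal{R}A_q+\sum_{q\in Q}C_q^TC_q .$$ *)

theory Defs
  imports "HOL-Analysis.Analysis"
begin

(* The dimensions n, m, p are the cardinalities of the index types. The matrix families are
   total functions on nat; only their values on Q = {1..D} are ever used. *)
record ('n, 'm, 'p) lss =
  num_modes :: nat
  mat_A :: "nat \<Rightarrow> real^'n^'n"
  mat_B :: "nat \<Rightarrow> real^'m^'n"
  mat_C :: "nat \<Rightarrow> real^'n^'p"

definition modes :: "('n::finite, 'm::finite, 'p::finite) lss \<Rightarrow> nat set" where
  "modes S = {1..num_modes S}"

definition l2_inputs :: "(nat \<Rightarrow> real^'m) set" where
  "l2_inputs = {u. summable (\<lambda>t. (norm (u t))\<^sup>2)}"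

definition switching_seqs :: "('n::finite, 'm::finite, 'p::finite) lss \<Rightarrow> (nat \<Rightarrow> nat) set" where
  "switching_seqs S = {q. \<forall>t. q t \<in> modes S}"

primrec state_traj ::
  "('n::finite, 'm::finite, 'p::finite) lss \<Rightarrow> real^'n \<Rightarrow> (nat \<Rightarrow> real^'m) \<Rightarrow> (nat \<Rightarrow> nat)
     \<Rightarrow> nat \<Rightarrow> real^'n" where
  "state_traj S x0 u q 0 = x0"
| "state_traj S x0 u q (Suc t) = mat_A S (q t) *v state_traj S x0 u q t + mat_B S (q t) *v u t"

definition output_traj ::
  "('n::finite, 'm::finite, 'p::finite) lss \<Rightarrow> real^'n \<Rightarrow> (nat \<Rightarrow> real^'m) \<Rightarrow> (nat \<Rightarrow> nat)
     \<Rightarrow> nat \<Rightarrow> real^'p" where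
  "output_traj S x0 u q t = mat_C S (q t) *v state_traj S x0 u q t"

(* Restricted to admissible inputs and switching sequences, so that equality of two
   such maps is equality as maps on that product only. *)
definition io_map ::
  "('n::finite, 'm::finite, 'p::finite) lss \<Rightarrow> real^'n
     \<Rightarrow> (nat \<Rightarrow> real^'m) \<times> (nat \<Rightarrow> nat) \<Rightarrow> nat \<Rightarrow> real^'p" where
  "io_map S x0 = restrict (\<lambda>(u, q). output_traj S x0 u q) (l2_inputs \<times> switching_seqs S)"

definition observable :: "('n::finite, 'm::finite, 'p::finite) lss \<Rightarrow> bool" where
  "observable S \<longleftrightarrow> (\<forall>x1 x2. x1 \<noteq> x2 \<longrightarrow> io_map S x1 \<noteq> io_map S x2)"

definition span_reachable :: "('n::finite, 'm::finite, 'p::finite) lss \<Rightarrow> bool" where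
  "span_reachable S \<longleftrightarrow>
     span {state_traj S 0 u q t | u q t. u \<in> l2_inputs \<and> q \<in> switching_seqs S} = UNIV"

definition kronecker ::
  "real^'b^'a \<Rightarrow> real^'d^'c \<Rightarrow> real^('b::finite \<times> 'd::finite)^('a::finite \<times> 'c::finite)" where
  "kronecker M N = (\<chi> i j. M $ fst i $ fst j * N $ snd i $ snd j)"

definition is_eigenvalue :: "real^'n^'n \<Rightarrow> complex \<Rightarrow> bool" where
  "is_eigenvalue M z \<longleftrightarrow> (\<exists>v. v \<noteq> 0 \<and> map_matrix complex_of_real M *v v = z *s v)"

definition strongly_stable :: "('n::finite, 'm::finite, 'p::finite) lss \<Rightarrow> bool" where
  "strongly_stable S \<longleftrightarrow>
     (\<forall>z. is_eigenvalue
            (\<Sum>q\<in>modes S. kronecker (transpose (mat_A S q)) (transpose (mat_A S q))) z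
          \<longrightarrow> norm z < 1)"

definition pos_semidef :: "real^'n^'n \<Rightarrow> bool" where
  "pos_semidef P \<longleftrightarrow> transpose P = P \<and> (\<forall>x. x \<bullet> (P *v x) \<ge> 0)"

definition pos_def :: "real^'n^'n \<Rightarrow> bool" where
  "pos_def P \<longleftrightarrow> transpose P = P \<and> (\<forall>x. x \<noteq> 0 \<longrightarrow> x \<bullet> (P *v x) > 0)"

definition ctrl_grammian :: "('n::finite, 'm::finite, 'p::finite) lss \<Rightarrow> real^'n^'n" where
  "ctrl_grammian S = (THE P. pos_semidef P \<and>
     P = (\<Sum>q\<in>modes S. mat_A S q ** P ** transpose (mat_A S q))
       + (\<Sum>q\<in>modes S. mat_B S q ** transpose (mat_B S q)))"

definition obs_grammian :: "('n::finite, 'm::finite, 'p::finite) lss \<Rightarrow> real^'n^'n" where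
  "obs_grammian S = (THE R. pos_semidef R \<and>
     R = (\<Sum>q\<in>modes S. transpose (mat_A S q) ** R ** mat_A S q)
       + (\<Sum>q\<in>modes S. transpose (mat_C S q) ** mat_C S q))"

end

theory Submission
  imports Defs
begin

text \<open>
Both equivalences are one statement about a finite matrix family \<open>F q\<close> and read-out matrices
\<open>D q\<close>. Let \<open>G\<close> be the positive semidefinite solution of
\<open>G = \<Sum>q. F q\<^sup>T G F q + \<Sum>q. D q\<^sup>T D q\<close>. As a quadratic form it satisfies
\<open>x \<bullet> G x = \<Sum>q. F q x \<bullet> G (F q x) + \<Sum>q. \<parallel>D q x\<parallel>\<^sup>2\<close>. Every summand is nonnegative, so the
null vectors of \<open>G\<close> form a set that is invariant under all \<open>F q\<close> and annihilated by all \<open>D q\<close>.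
Conversely, on any such invariant set the form is only redistributed along the \<open>F q\<close>, and
stability forces it to vanish there (\<open>subinvariant_quad_nonpos\<close>). Hence \<open>G\<close> is positive
definite if and only if no nonzero state is silent (\<open>pos_def_grammian_iff\<close>). For \<open>F = A\<close>,
\<open>D = C\<close> the silent states are those that never produce an output, which gives observability.
For \<open>F = A\<^sup>T\<close>, \<open>D = B\<^sup>T\<close> they are the vectors orthogonal to all reachable states, which
gives span-reachability.

Strong stability enters only through the fact that the operator \<open>V \<mapsto> \<Sum>q. F q\<^sup>T V F q\<close> has no real
eigenvalue \<open>\<ge> 1\<close>, a property that passes to the adjoint operator and hence from \<open>A\<close> to \<open>A\<^sup>T\<close>.
No power of the operator has to be estimated through its spectral radius: this operator preserves
nonnegative forms, so the solution of \<open>X = t \<Sum>q. F q\<^sup>T X F q + 1\<close> can be followed from \<open>t = 0\<close> to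
\<open>t = 1\<close> without ever losing positivity. At \<open>t = 1\<close> it is a Lyapunov function \<open>X \<ge> 1\<close>
(\<open>lyapunov_function_exists\<close>). Everything that is needed about decay, including the existence,
uniqueness and semidefiniteness of the grammians, follows from the absence of these eigenvalues
and from \<open>X\<close>.
\<close>

section \<open>Continuation of solutions of linear equations\<close>

text \<open>Compactness of \<open>[0, 1]\<close> times the unit sphere turns injectivity for each single \<open>t\<close> into a
bound that is uniform in \<open>t\<close>.\<close>

lemma homotopy_bounded_below:
  fixes T :: "'a::euclidean_space \<Rightarrow> 'a"
  assumes T: "linear T" and inj: "\<forall>t\<in>{0..1}. \<forall>v. v = t *\<^sub>R T v \<longrightarrow> v = 0"
  shows "\<exists>c>0. \<forall>t\<in>{0..1}. \<forall>v. c * norm v \<le> norm (v - t *\<^sub>R T v)"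
proof -
  let ?K = "{0..1::real} \<times> sphere (0::'a) 1"
  let ?f = "\<lambda>p. norm (snd p - fst p *\<^sub>R T (snd p))"
  obtain b :: 'a where "b \<in> Basis" using nonempty_Basis by blast
  then have ne: "?K \<noteq> {}" by auto
  have "continuous_on ?K ?f"
    by (intro continuous_intros linear_continuous_on_compose[OF _ T])
  moreover have "compact ?K" by (intro compact_Times) auto
  ultimately obtain p where p: "p \<in> ?K" and min: "\<And>r. r \<in> ?K \<Longrightarrow> ?f p \<le> ?f r"
    using continuous_attains_inf[of ?K ?f] ne by blast
  define c where "c = ?f p"
  have "snd p \<noteq> 0" using p by (cases p) auto
  then have "c > 0"
    using p bspec[OF inj, of "fst p"] by (cases p) (auto simp: c_def)
  moreover have "c * norm v \<le> norm (v - t *\<^sub>R T v)" if t: "t \<in> {0..1}" for t v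
  proof (cases "v = 0")
    case False
    let ?u = "(1 / norm v) *\<^sub>R v"
    have "c \<le> norm (?u - t *\<^sub>R T ?u)"
      using min[of "(t, ?u)"] t False by (simp add: c_def)
    also have "?u - t *\<^sub>R T ?u = (1 / norm v) *\<^sub>R (v - t *\<^sub>R T v)"
      using T by (simp add: linear_cmul algebra_simps)
    finally have "c \<le> norm (v - t *\<^sub>R T v) / norm v" by simp
    then show ?thesis using False by (simp add: pos_le_divide_eq)
  qed simp
  ultimately show ?thesis by blast
qed

text \<open>The solution of \<open>X = t T X + W\<close> is Lipschitz in \<open>t\<close>, by the uniform bound above. A property
that survives perturbations of one fixed size \<open>d\<close> along this path therefore travels from \<open>t = 0\<close>
to \<open>t = 1\<close> in finitely many equal steps.\<close>

lemma continuation: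
  fixes T :: "'a::euclidean_space \<Rightarrow> 'a"
  assumes T: "linear T" and inj: "\<forall>t\<in>{0..1}. \<forall>v. v = t *\<^sub>R T v \<longrightarrow> v = 0"
    and "d > 0" and start: "P W"
    and step: "\<And>t X Y. \<lbrakk>0 \<le> t; t \<le> 1; X = t *\<^sub>R T X + W; P X; norm (Y - X) < d\<rbrakk> \<Longrightarrow> P Y"
  obtains X where "X = T X + W" "P X"
proof -
  obtain c where c: "c > 0"
    and below: "\<forall>t\<in>{0..1}. \<forall>v. c * norm v \<le> norm (v - t *\<^sub>R T v)"
    using homotopy_bounded_below[OF T inj] by blast
  obtain L where L: "L > 0" "\<And>v. norm (T v) \<le> L * norm v"
    using linear_bounded_pos[OF T] by blast
  have solvable: "\<exists>X. X = t *\<^sub>R T X + W" if "0 \<le> t" "t \<le> 1" for t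
  proof -
    have lin: "linear (\<lambda>v. v - t *\<^sub>R T v)"
      by (intro linear_compose_sub linear_compose_scale_right T linear_ident)
    have "inj (\<lambda>v. v - t *\<^sub>R T v)"
      using bspec[OF inj, of t] that by (simp add: linear_injective_0[OF lin])
    then have "surj (\<lambda>v. v - t *\<^sub>R T v)"
      by (rule linear_inj_imp_surj[OF lin])
    then obtain X where "W = X - t *\<^sub>R T X" by (rule surjE)
    then show ?thesis by (intro exI[of _ X]) (simp add: algebra_simps)
  qed
  \<comment> \<open>Lipschitz constant of the path: \<open>\<parallel>X\<parallel> \<le> \<parallel>W\<parallel> / c\<close>, and the difference of two solutions
    solves the equation at \<open>s\<close> with right-hand side \<open>(s - t) T X\<close>.\<close>
  define K where "K = L * norm W / (c * c)"
  have close: "norm (Y - X) \<le> \<bar>s - t\<bar> * K"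
    if ts: "0 \<le> t" "t \<le> 1" "0 \<le> s" "s \<le> 1" and X: "X = t *\<^sub>R T X + W" and Y: "Y = s *\<^sub>R T Y + W"
    for s t X Y
  proof -
    have "X - t *\<^sub>R T X = W" using X by (metis add_diff_cancel_left')
    then have "c * norm X \<le> norm W" using bspec[OF below, of t] ts by (metis atLeastAtMost_iff)
    have "(Y - X) - s *\<^sub>R T (Y - X) = (Y - s *\<^sub>R T Y) - (X - t *\<^sub>R T X) + (s - t) *\<^sub>R T X"
      using T by (simp add: linear_diff algebra_simps)
    also have "\<dots> = (s - t) *\<^sub>R T X"
      using X Y by (metis add_diff_cancel_left' diff_self add_0)
    finally have "c * norm (Y - X) \<le> \<bar>s - t\<bar> * norm (T X)"
      using bspec[OF below, of s] ts by (metis atLeastAtMost_iff norm_scaleR)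
    also have "\<dots> \<le> \<bar>s - t\<bar> * (L * (norm W / c))"
      using L \<open>c * norm X \<le> norm W\<close> c
      by (intro mult_left_mono order_trans[OF L(2)]) (auto simp: field_simps)
    finally show ?thesis using c by (simp add: K_def field_simps)
  qed
  obtain n :: nat where n: "K / d < real n" using reals_Archimedean2 by blast
  have "K \<ge> 0" using L by (simp add: K_def)
  then have "n > 0" using n \<open>d > 0\<close> by (metis divide_nonneg_pos gr0I not_less of_nat_0)
  have "\<exists>X. X = (real k / real n) *\<^sub>R T X + W \<and> P X" if "k \<le> n" for k
    using that
  proof (induction k)
    case 0
    show ?case using start by simp
  next
    case (Suc k)
    let ?t = "real k / real n" and ?s = "real (Suc k) / real n"
    have ts: "0 \<le> ?t" "?t \<le> 1" "0 \<le> ?s" "?s \<le> 1"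
      using Suc.prems \<open>n > 0\<close> by auto
    obtain X where X: "X = ?t *\<^sub>R T X + W" "P X" using Suc.IH Suc.prems Suc_leD by blast
    obtain Y where Y: "Y = ?s *\<^sub>R T Y + W" using solvable[of ?s] ts by blast
    have "norm (Y - X) \<le> \<bar>?s - ?t\<bar> * K" by (rule close[OF ts X(1) Y])
    also have "\<bar>?s - ?t\<bar> = 1 / real n" by (simp flip: diff_divide_distrib)
    also have "1 / real n * K < d" using n \<open>n > 0\<close> \<open>d > 0\<close> by (simp add: field_simps)
    finally have "P Y" by (rule step[OF ts(1,2) X])
    with Y show ?case by blast
  qed
  from this[of n] \<open>n > 0\<close> have "\<exists>X. X = T X + W \<and> P X" by simp
  with that show ?thesis by blast
qed

section \<open>Lyapunov operators and their quadratic forms\<close>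

abbreviation quad :: "real^'n^'n \<Rightarrow> real^'n \<Rightarrow> real" where
  "quad V x \<equiv> x \<bullet> (V *v x)"

definition lyapunov :: "'q set \<Rightarrow> ('q \<Rightarrow> real^'n^'n) \<Rightarrow> real^'n^'n \<Rightarrow> real^'n^'n" where
  "lyapunov Q F V = (\<Sum>q\<in>Q. transpose (F q) ** V ** F q)"

text \<open>The trace of strong stability that the argument uses. Unlike the bound on the complex spectrum
it speaks of real matrices \<open>V\<close> only.\<close>

definition lyapunov_stable :: "'q set \<Rightarrow> ('q \<Rightarrow> real^'n^'n) \<Rightarrow> bool" where
  "lyapunov_stable Q F \<longleftrightarrow> (\<forall>s V. s \<ge> 1 \<and> lyapunov Q F V = s *\<^sub>R V \<longrightarrow> V = 0)"

lemma lyapunov_stableD: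
  "\<lbrakk>lyapunov_stable Q F; lyapunov Q F V = s *\<^sub>R V; s \<ge> 1\<rbrakk> \<Longrightarrow> V = 0"
  by (auto simp: lyapunov_stable_def)

lemma linear_congruence: "linear (\<lambda>V :: real^'n^'m. A ** V ** (B :: real^'k^'n))"
  by (rule linearI)
    (simp_all add: vec_eq_iff matrix_matrix_mult_def sum_distrib_left sum_distrib_right
      sum.distrib distrib_left distrib_right mult_ac)

lemma linear_lyapunov: "linear (lyapunov Q F)"
  unfolding lyapunov_def by (intro linear_compose_sum ballI linear_congruence)

lemma linear_quad: "linear (\<lambda>V. quad V x)"
  by (rule linearI)
    (simp_all add: matrix_vector_mult_add_rdistrib inner_add_right flip: scaleR_matrix_vector_assoc)

lemma inner_matrix_transpose: "x \<bullet> (A *v y) = (transpose A *v x) \<bullet> (y :: real^'n)"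
  by (simp add: dot_lmul_matrix)

lemma quad_congruence: "quad (transpose A ** V ** A) x = quad V (A *v x)"
  using inner_matrix_transpose[of x "transpose A" "V *v (A *v x)"]
  by (simp flip: matrix_vector_mul_assoc)

lemma quad_gram: "quad (transpose D ** D) x = (norm (D *v x))\<^sup>2"
  using inner_matrix_transpose[of x "transpose D" "D *v x"]
  by (simp add: dot_square_norm flip: matrix_vector_mul_assoc)

lemma quad_lyapunov: "quad (lyapunov Q F V) x = (\<Sum>q\<in>Q. quad V (F q *v x))"
  unfolding lyapunov_def linear_sum[OF linear_quad] by (simp add: quad_congruence)

lemma quad_bound:
  obtains k where "k > 0" "\<And>(V :: real^'n^'n) x. \<bar>quad V x\<bar> \<le> k * norm V * (norm x)\<^sup>2"
proof -
  have "bilinear (\<lambda>(V :: real^'n^'n) x. V *v x)"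
    unfolding bilinear_def
    by (auto intro!: linearI simp: algebra_simps simp flip: scaleR_matrix_vector_assoc)
  then obtain k where k: "k > 0" "\<And>(V :: real^'n^'n) x. norm (V *v x) \<le> k * norm V * norm x"
    using bilinear_bounded_pos by blast
  have "\<bar>quad V x\<bar> \<le> k * norm V * (norm x)\<^sup>2" for V :: "real^'n^'n" and x
  proof -
    have "\<bar>quad V x\<bar> \<le> norm x * norm (V *v x)" by (rule Cauchy_Schwarz_ineq2)
    also have "\<dots> \<le> norm x * (k * norm V * norm x)" by (intro mult_left_mono k) auto
    finally show ?thesis by (simp add: power2_eq_square algebra_simps)
  qed
  with k that show ?thesis by blast
qed

lemma transpose_add: "transpose (A + B) = transpose A + transpose B"
  by (simp add: vec_eq_iff transpose_def)

lemma transpose_sum: "transpose (\<Sum>q\<in>Q. A q) = (\<Sum>q\<in>Q. transpose (A q))"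
  by (simp add: vec_eq_iff transpose_def)

lemma transpose_lyapunov: "transpose (lyapunov Q F V) = lyapunov Q F (transpose V)"
  by (simp add: lyapunov_def transpose_sum matrix_transpose_mul matrix_mul_assoc)

lemma inner_matrix_mult_left:
  fixes U :: "real^'k^'n"
  shows "U \<bullet> (A ** W) = (transpose A ** U) \<bullet> W"
proof -
  have "U \<bullet> (A ** W) = (\<Sum>i\<in>UNIV. \<Sum>j\<in>UNIV. \<Sum>k\<in>UNIV. U$i$j * (A$i$k * W$k$j))"
    by (simp add: inner_vec_def matrix_matrix_mult_def sum_distrib_left)
  also have "\<dots> = (\<Sum>i\<in>UNIV. \<Sum>k\<in>UNIV. \<Sum>j\<in>UNIV. U$i$j * (A$i$k * W$k$j))"
    by (intro sum.cong refl sum.swap)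
  also have "\<dots> = (\<Sum>k\<in>UNIV. \<Sum>i\<in>UNIV. \<Sum>j\<in>UNIV. U$i$j * (A$i$k * W$k$j))"
    by (rule sum.swap)
  also have "\<dots> = (\<Sum>k\<in>UNIV. \<Sum>j\<in>UNIV. \<Sum>i\<in>UNIV. U$i$j * (A$i$k * W$k$j))"
    by (intro sum.cong refl sum.swap)
  also have "\<dots> = (transpose A ** U) \<bullet> W"
    by (simp add: inner_vec_def matrix_matrix_mult_def transpose_def sum_distrib_left sum_distrib_right
        mult_ac)
  finally show ?thesis .
qed

lemma inner_matrix_mult_right:
  fixes U :: "real^'k^'n"
  shows "U \<bullet> (W ** A) = (U ** transpose A) \<bullet> W"
proof -
  have "U \<bullet> (W ** A) = (\<Sum>i\<in>UNIV. \<Sum>j\<in>UNIV. \<Sum>k\<in>UNIV. U$i$j * (W$i$k * A$k$j))"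
    by (simp add: inner_vec_def matrix_matrix_mult_def sum_distrib_left)
  also have "\<dots> = (\<Sum>i\<in>UNIV. \<Sum>k\<in>UNIV. \<Sum>j\<in>UNIV. U$i$j * (W$i$k * A$k$j))"
    by (intro sum.cong refl sum.swap)
  also have "\<dots> = (U ** transpose A) \<bullet> W"
    by (simp add: inner_vec_def matrix_matrix_mult_def transpose_def sum_distrib_left sum_distrib_right
        mult_ac)
  finally show ?thesis .
qed

lemma inner_congruence:
  "(U :: real^'n^'n) \<bullet> (transpose A ** V ** A) = (A ** U ** transpose A) \<bullet> V"
  unfolding inner_matrix_mult_right[of U "transpose A ** V"]
    inner_matrix_mult_left[of "U ** _" "transpose A"]
  by (simp add: matrix_mul_assoc)

lemma lyapunov_solution:
  assumes "lyapunov_stable Q F"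
  shows "\<exists>!V. V = lyapunov Q F V + W"
proof -
  have lin: "linear (\<lambda>V. V - lyapunov Q F V)"
    by (intro linear_compose_sub linear_lyapunov linear_ident)
  have inj: "inj (\<lambda>V. V - lyapunov Q F V)"
    using lyapunov_stableD[OF assms, of _ 1] by (simp add: linear_injective_0[OF lin])
  then have "surj (\<lambda>V. V - lyapunov Q F V)"
    by (rule linear_inj_imp_surj[OF lin])
  then obtain V where V: "W = V - lyapunov Q F V" by (rule surjE)
  show ?thesis
  proof (rule ex1I[of _ V])
    show "V = lyapunov Q F V + W" using V by simp
    fix U assume "U = lyapunov Q F U + W"
    then have "U - lyapunov Q F U = V - lyapunov Q F V" using V by (metis add_diff_cancel_left')
    with inj show "U = V" by (rule injD)
  qed
qed

text \<open>By \<open>inner_congruence\<close> the Lyapunov operators of \<open>F\<close> and of its transposes are adjoint for the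
entrywise inner product, and in finite dimension injectivity of \<open>s - T\<close> passes to the adjoint
through surjectivity.\<close>

lemma lyapunov_stable_transpose:
  assumes "lyapunov_stable Q F"
  shows "lyapunov_stable Q (\<lambda>q. transpose (F q))"
  unfolding lyapunov_stable_def
proof (intro allI impI, elim conjE)
  fix s :: real and V
  assume s: "s \<ge> 1" and V: "lyapunov Q (\<lambda>q. transpose (F q)) V = s *\<^sub>R V"
  have lin: "linear (\<lambda>U. s *\<^sub>R U - lyapunov Q F U)"
    by (intro linear_compose_sub linear_lyapunov linear_compose_scale_right linear_ident)
  have "inj (\<lambda>U. s *\<^sub>R U - lyapunov Q F U)"
    using lyapunov_stableD[OF assms _ s] by (simp add: linear_injective_0[OF lin])
  then have "surj (\<lambda>U. s *\<^sub>R U - lyapunov Q F U)"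
    by (rule linear_inj_imp_surj[OF lin])
  then obtain U where U: "V = s *\<^sub>R U - lyapunov Q F U" by (rule surjE)
  have "V \<bullet> lyapunov Q F U = lyapunov Q (\<lambda>q. transpose (F q)) V \<bullet> U"
    by (simp add: lyapunov_def inner_sum_left inner_sum_right inner_congruence)
  then have "V \<bullet> V = 0"
    unfolding V using arg_cong[OF U, of "\<lambda>W. V \<bullet> W"] by (simp add: inner_diff_right)
  then show "V = 0" by simp
qed

text \<open>The self-improving step behind the continuation: a solution whose form is merely nonnegative
satisfies \<open>X \<ge> 1\<close>, because the Lyapunov operator keeps \<open>t \<Sum>q. F q\<^sup>T X F q\<close> nonnegative. So it stays
nonnegative under perturbations of a size that does not depend on \<open>t\<close>.\<close>

lemma lyapunov_function_exists:
  fixes F :: "'q \<Rightarrow> real^'n^'n"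
  assumes "lyapunov_stable Q F"
  obtains (solution) X where "X = lyapunov Q F X + mat 1" "\<And>x. quad X x \<ge> 0"
proof -
  obtain k where k: "k > 0" "\<And>(V :: real^'n^'n) x. \<bar>quad V x\<bar> \<le> k * norm V * (norm x)\<^sup>2"
    using quad_bound by blast
  have inj: "V = 0" if "0 \<le> t" "t \<le> 1" "V = t *\<^sub>R lyapunov Q F V" for t V
  proof (cases "t = 0")
    case False
    have "lyapunov Q F V = (1 / t) *\<^sub>R (t *\<^sub>R lyapunov Q F V)" using False by simp
    also have "\<dots> = (1 / t) *\<^sub>R V" using that(3) by simp
    finally show ?thesis
      by (rule lyapunov_stableD[OF assms]) (use that False in simp)
  qed (use that in simp)
  have keep: "\<forall>x. quad Y x \<ge> 0"
    if t: "0 \<le> t" "t \<le> 1" and X: "X = t *\<^sub>R lyapunov Q F X + mat 1" and pos: "\<forall>x. quad X x \<ge> 0"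
      and near: "norm (Y - X) < 1 / k" for t X Y
  proof
    fix x
    have "quad X x = quad (t *\<^sub>R lyapunov Q F X + mat 1) x"
      by (rule arg_cong[OF X, of "\<lambda>V. quad V x"])
    also have "\<dots> = t * (\<Sum>q\<in>Q. quad X (F q *v x)) + (norm x)\<^sup>2"
      by (simp add: linear_add[OF linear_quad] linear_cmul[OF linear_quad] quad_lyapunov
          dot_square_norm)
    finally have "quad X x \<ge> (norm x)\<^sup>2" using t pos by (simp add: sum_nonneg)
    moreover have "\<bar>quad (Y - X) x\<bar> \<le> (norm x)\<^sup>2"
    proof -
      have "k * norm (Y - X) \<le> 1" using near k(1) by (simp add: field_simps)
      then have "k * norm (Y - X) * (norm x)\<^sup>2 \<le> 1 * (norm x)\<^sup>2"
        by (rule mult_right_mono) simp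
      then show ?thesis using k(2)[of x "Y - X"] by linarith
    qed
    ultimately show "quad Y x \<ge> 0" by (simp add: linear_diff[OF linear_quad])
  qed
  show ?thesis
  proof (rule continuation[where T = "lyapunov Q F" and W = "mat 1" and d = "1 / k"
        and P = "\<lambda>X. \<forall>x. quad X x \<ge> 0"])
    show "0 < 1 / k" using k(1) by simp
    show "\<forall>x. quad (mat 1) x \<ge> 0" by simp
    show thesis if "X = lyapunov Q F X + mat 1" "\<forall>x. quad X x \<ge> 0" for X
      by (rule solution[OF that(1)]) (rule that(2)[THEN spec])
    show "\<forall>t\<in>{0..1}. \<forall>V. V = t *\<^sub>R lyapunov Q F V \<longrightarrow> V = 0"
      by (intro ballI allI impI, rule inj) auto
    show "\<forall>x. quad Y x \<ge> 0"
      if "0 \<le> t" "t \<le> 1" "X = t *\<^sub>R lyapunov Q F X + mat 1" "\<forall>x. quad X x \<ge> 0"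
        "norm (Y - X) < 1 / k" for t X Y
      by (rule keep[OF that])
  qed (rule linear_lyapunov)
qed

text \<open>One application of the \<open>F q\<close> shrinks the Lyapunov function \<open>X\<close> by a fixed factor \<open>r < 1\<close>. A form
\<open>V\<close> that does not decrease under the \<open>F q\<close> on \<open>N\<close> is bounded by a multiple of \<open>X\<close>, hence by
\<open>r ^ m\<close> times this multiple for every \<open>m\<close>. Restricting to an invariant set \<open>N\<close> lets the lemma serve
twice: with \<open>N = UNIV\<close> for the semidefiniteness of the grammian, and with \<open>N\<close> inside the kernel of
the read-outs for its null vectors.\<close>

lemma subinvariant_quad_nonpos:
  fixes F :: "'q \<Rightarrow> real^'n^'n"
  assumes stable: "lyapunov_stable Q F"
    and inv: "\<And>x q. \<lbrakk>x \<in> N; q \<in> Q\<rbrakk> \<Longrightarrow> F q *v x \<in> N"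
    and sub: "\<And>x. x \<in> N \<Longrightarrow> quad V x \<le> (\<Sum>q\<in>Q. quad V (F q *v x))"
    and "x \<in> N"
  shows "quad V x \<le> 0"
proof -
  obtain X where X: "X = lyapunov Q F X + mat 1" and pos: "\<And>x. quad X x \<ge> 0"
    using lyapunov_function_exists[OF stable] by blast
  obtain k where k: "k > 0" "\<And>(V :: real^'n^'n) x. \<bar>quad V x\<bar> \<le> k * norm V * (norm x)\<^sup>2"
    using quad_bound by blast
  have decrease: "(\<Sum>q\<in>Q. quad X (F q *v x)) = quad X x - (norm x)\<^sup>2" for x
  proof -
    have "quad X x = quad (lyapunov Q F X + mat 1) x"
      by (rule arg_cong[OF X, of "\<lambda>V. quad V x"])
    then show ?thesis
      by (simp add: linear_add[OF linear_quad] quad_lyapunov dot_square_norm)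
  qed
  have lower: "(norm x)\<^sup>2 \<le> quad X x" for x
    using decrease[of x] sum_nonneg[of Q "\<lambda>q. quad X (F q *v x)"] pos by simp
  \<comment> \<open>The form of \<open>X\<close> lies between \<open>\<parallel>x\<parallel>\<^sup>2\<close> and \<open>c \<parallel>x\<parallel>\<^sup>2\<close>, so subtracting \<open>\<parallel>x\<parallel>\<^sup>2\<close> costs
    at least the fraction \<open>1 / c\<close>. The summand \<open>1\<close> keeps \<open>r\<close> nonnegative.\<close>
  define c where "c = k * norm X + 1"
  define r where "r = 1 - 1 / c"
  have "c \<ge> 1" using k(1) by (simp add: c_def)
  then have r: "0 \<le> r" "r < 1" by (auto simp: r_def)
  have contract: "quad X x - (norm x)\<^sup>2 \<le> r * quad X x" for x
  proof -
    have "quad X x \<le> k * norm X * (norm x)\<^sup>2" using k(2)[of x X] by linarith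
    also have "\<dots> \<le> c * (norm x)\<^sup>2" by (intro mult_right_mono) (auto simp: c_def)
    finally show ?thesis using \<open>c \<ge> 1\<close> by (simp add: r_def field_simps)
  qed
  define b where "b = k * norm V"
  have "b \<ge> 0" using k(1) by (simp add: b_def)
  have decay: "quad V x \<le> b * r ^ m * quad X x" if "x \<in> N" for m x
    using that
  proof (induction m arbitrary: x)
    case 0
    have "quad V x \<le> b * (norm x)\<^sup>2" using k(2)[of x V] by (simp add: b_def)
    also have "\<dots> \<le> b * quad X x" using lower \<open>b \<ge> 0\<close> by (rule mult_left_mono)
    finally show ?case by simp
  next
    case (Suc m)
    have "quad V x \<le> (\<Sum>q\<in>Q. quad V (F q *v x))" using Suc.prems by (rule sub)
    also have "\<dots> \<le> (\<Sum>q\<in>Q. b * r ^ m * quad X (F q *v x))"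
      using Suc inv by (intro sum_mono) auto
    also have "\<dots> = b * r ^ m * (quad X x - (norm x)\<^sup>2)"
      by (simp add: decrease flip: sum_distrib_left)
    also have "\<dots> \<le> b * r ^ m * (r * quad X x)"
      using contract \<open>b \<ge> 0\<close> r by (intro mult_left_mono) auto
    finally show ?case by (simp add: algebra_simps)
  qed
  have "(\<lambda>m. b * r ^ m * quad X x) \<longlonglongrightarrow> b * 0 * quad X x"
    using r by (intro tendsto_intros LIMSEQ_power_zero) auto
  then show ?thesis
    using LIMSEQ_le_const[of _ _ "quad V x"] decay[OF \<open>x \<in> N\<close>] by fastforce
qed

section \<open>The grammian and its kernel\<close>

definition grammian :: "'q set \<Rightarrow> ('q \<Rightarrow> real^'n^'n) \<Rightarrow> ('q \<Rightarrow> real^'n^'p) \<Rightarrow> real^'n^'n" where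
  "grammian Q F D = (THE G. pos_semidef G \<and>
     G = lyapunov Q F G + (\<Sum>q\<in>Q. transpose (D q) ** D q))"

text \<open>The union of all invariant sets inside the common kernel of the read-outs: in control-theoretic
terms the unobservable subspace of the pair \<open>(F, D)\<close>. Exhibiting or using one invariant set
replaces an induction over products of the \<open>F q\<close>.\<close>

definition silent :: "'q set \<Rightarrow> ('q \<Rightarrow> real^'n^'n) \<Rightarrow> ('q \<Rightarrow> real^'n^'p) \<Rightarrow> real^'n \<Rightarrow> bool" where
  "silent Q F D x \<longleftrightarrow>
     (\<exists>N. x \<in> N \<and> (\<forall>y\<in>N. \<forall>q\<in>Q. D q *v y = 0 \<and> F q *v y \<in> N))"

lemma quad_lyapunov_equation:
  assumes "G = lyapunov Q F G + (\<Sum>q\<in>Q. transpose (D q) ** D q)"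
  shows "quad G x = (\<Sum>q\<in>Q. quad G (F q *v x)) + (\<Sum>q\<in>Q. (norm (D q *v x))\<^sup>2)"
proof -
  have "quad G x = quad (lyapunov Q F G + (\<Sum>q\<in>Q. transpose (D q) ** D q)) x"
    by (rule arg_cong[OF assms, of "\<lambda>V. quad V x"])
  then show ?thesis
    by (simp add: linear_add[OF linear_quad] linear_sum[OF linear_quad] quad_lyapunov quad_gram)
qed

lemma grammian_properties:
  fixes D :: "'q \<Rightarrow> real^'n^'p"
  assumes stable: "lyapunov_stable Q F"
  shows "pos_semidef (grammian Q F D)"
    and "grammian Q F D = lyapunov Q F (grammian Q F D) + (\<Sum>q\<in>Q. transpose (D q) ** D q)"
proof -
  let ?W = "\<Sum>q\<in>Q. transpose (D q) ** D q"
  obtain G where G: "G = lyapunov Q F G + ?W"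
    and uniq: "\<And>V. V = lyapunov Q F V + ?W \<Longrightarrow> V = G"
    using lyapunov_solution[OF stable, of ?W] by blast
  have "transpose G = transpose (lyapunov Q F G + ?W)"
    by (rule arg_cong[OF G])
  also have "\<dots> = lyapunov Q F (transpose G) + ?W"
    by (simp add: transpose_add transpose_lyapunov transpose_sum matrix_transpose_mul)
  finally have "transpose G = G" by (rule uniq)
  moreover have "quad G x \<ge> 0" for x
  proof -
    have "quad (- G) x \<le> 0"
    proof (rule subinvariant_quad_nonpos[OF stable, of UNIV])
      fix y
      have "quad G y \<ge> (\<Sum>q\<in>Q. quad G (F q *v y))"
        using quad_lyapunov_equation[OF G, of y] by (simp add: sum_nonneg)
      then show "quad (- G) y \<le> (\<Sum>q\<in>Q. quad (- G) (F q *v y))"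
        by (simp add: linear_neg[OF linear_quad] sum_negf)
    qed auto
    then show ?thesis by (simp add: linear_neg[OF linear_quad])
  qed
  ultimately have psd: "pos_semidef G" by (simp add: pos_semidef_def)
  have eq: "grammian Q F D = G"
    unfolding grammian_def by (rule the_equality, rule conjI[OF psd G], rule uniq, rule conjunct2)
  show "pos_semidef (grammian Q F D)" unfolding eq by (rule psd)
  show "grammian Q F D = lyapunov Q F (grammian Q F D) + ?W" unfolding eq by (rule G)
qed

text \<open>The null vectors of the grammian are themselves an invariant set inside the kernel, since the form
at \<open>x\<close> is a sum of nonnegative terms; conversely the form is subinvariant on every such set.\<close>

lemma quad_grammian_eq_0_iff_silent:
  assumes stable: "lyapunov_stable Q F" and "finite Q"
  shows "quad (grammian Q F D) x = 0 \<longleftrightarrow> silent Q F D x"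
proof
  let ?G = "grammian Q F D"
  note G = grammian_properties[OF stable, of D]
  have pos: "quad ?G x \<ge> 0" for x using G(1) by (simp add: pos_semidef_def)
  note eq = quad_lyapunov_equation[OF G(2)]
  {
    assume "quad ?G x = 0"
    moreover have "D q *v y = 0 \<and> quad ?G (F q *v y) = 0" if "quad ?G y = 0" "q \<in> Q" for y q
    proof -
      have "(\<Sum>q\<in>Q. quad ?G (F q *v y)) \<ge> 0" "(\<Sum>q\<in>Q. (norm (D q *v y))\<^sup>2) \<ge> 0"
        using pos by (auto intro: sum_nonneg)
      then have "(\<Sum>q\<in>Q. quad ?G (F q *v y)) = 0" "(\<Sum>q\<in>Q. (norm (D q *v y))\<^sup>2) = 0"
        using eq[of y] that(1) by linarith+
      then show ?thesis
        using that(2) \<open>finite Q\<close> pos by (simp add: sum_nonneg_eq_0_iff)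
    qed
    ultimately show "silent Q F D x"
      unfolding silent_def by (intro exI[of _ "{y. quad ?G y = 0}"]) auto
  }
  assume "silent Q F D x"
  then obtain N where N: "x \<in> N" "\<And>y q. \<lbrakk>y \<in> N; q \<in> Q\<rbrakk> \<Longrightarrow> D q *v y = 0 \<and> F q *v y \<in> N"
    unfolding silent_def by blast
  have "quad ?G x \<le> 0"
  proof (rule subinvariant_quad_nonpos[OF stable, of N])
    fix y assume "y \<in> N"
    then have "(\<Sum>q\<in>Q. (norm (D q *v y))\<^sup>2) = 0" using N(2) by simp
    then show "quad ?G y \<le> (\<Sum>q\<in>Q. quad ?G (F q *v y))" using eq[of y] by linarith
  qed (use N in auto)
  with pos[of x] show "quad ?G x = 0" by simp
qed

lemma pos_def_grammian_iff:
  assumes "lyapunov_stable Q F" and "finite Q"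
  shows "pos_def (grammian Q F D) \<longleftrightarrow> (\<forall>x. silent Q F D x \<longrightarrow> x = 0)"
  using grammian_properties(1)[OF assms(1), of D]
  unfolding pos_def_def pos_semidef_def quad_grammian_eq_0_iff_silent[OF assms, symmetric]
  by (metis order_less_le order_less_irrefl)

section \<open>Strong stability\<close>

text \<open>The matrix in the definition of strong stability is the Lyapunov operator of \<open>A\<close> in coordinates:
an eigenmatrix \<open>V\<close>, read as a vector indexed by pairs, is an eigenvector of it.\<close>

lemma strongly_stable_imp_lyapunov_stable:
  assumes "strongly_stable S"
  shows "lyapunov_stable (modes S) (mat_A S)"
  unfolding lyapunov_stable_def
proof (intro allI impI, elim conjE, rule ccontr)
  fix s :: real and V
  assume s: "s \<ge> 1" and V: "lyapunov (modes S) (mat_A S) V = s *\<^sub>R V" and "V \<noteq> 0"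
  let ?M = "\<Sum>q\<in>modes S. kronecker (transpose (mat_A S q)) (transpose (mat_A S q))"
  define v where "v = (\<chi> p. complex_of_real (V $ fst p $ snd p))"
  have "v \<noteq> 0" using \<open>V \<noteq> 0\<close> by (auto simp: v_def vec_eq_iff)
  have "(\<Sum>p\<in>UNIV. ?M $ i $ p * V $ fst p $ snd p) = s * V $ fst i $ snd i" for i
  proof -
    have "(\<Sum>p\<in>UNIV. ?M $ i $ p * V $ fst p $ snd p)
        = (\<Sum>(j, l)\<in>UNIV \<times> UNIV. \<Sum>q\<in>modes S.
            mat_A S q $ j $ fst i * mat_A S q $ l $ snd i * V $ j $ l)"
      by (simp add: kronecker_def transpose_def sum_distrib_right case_prod_unfold)
    also have "\<dots> = (\<Sum>j\<in>UNIV. \<Sum>l\<in>UNIV. \<Sum>q\<in>modes S.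
            mat_A S q $ j $ fst i * mat_A S q $ l $ snd i * V $ j $ l)"
      by (rule sum.cartesian_product[symmetric])
    also have "\<dots> = (\<Sum>j\<in>UNIV. \<Sum>q\<in>modes S. \<Sum>l\<in>UNIV.
            mat_A S q $ j $ fst i * mat_A S q $ l $ snd i * V $ j $ l)"
      by (intro sum.cong refl sum.swap)
    also have "\<dots> = (\<Sum>q\<in>modes S. \<Sum>j\<in>UNIV. \<Sum>l\<in>UNIV.
            mat_A S q $ j $ fst i * mat_A S q $ l $ snd i * V $ j $ l)"
      by (rule sum.swap)
    also have "\<dots> = (\<Sum>q\<in>modes S. \<Sum>l\<in>UNIV. \<Sum>j\<in>UNIV.
            mat_A S q $ j $ fst i * mat_A S q $ l $ snd i * V $ j $ l)"
      by (intro sum.cong refl sum.swap)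
    also have "\<dots> = lyapunov (modes S) (mat_A S) V $ fst i $ snd i"
      by (simp add: lyapunov_def matrix_matrix_mult_def transpose_def sum_distrib_left
          sum_distrib_right mult_ac)
    finally show ?thesis using V by simp
  qed
  then have "map_matrix complex_of_real ?M *v v = complex_of_real s *s v"
    by (simp add: vec_eq_iff map_matrix_def matrix_vector_mult_def v_def
        flip: of_real_mult of_real_sum)
  with \<open>v \<noteq> 0\<close> have "is_eigenvalue ?M (complex_of_real s)"
    unfolding is_eigenvalue_def by blast
  with assms s show False
    unfolding strongly_stable_def by fastforce
qed

section \<open>Observability and span-reachability\<close>

lemma zero_in_l2_inputs: "(\<lambda>_. 0) \<in> l2_inputs"
  by (simp add: l2_inputs_def)

lemma state_traj_diff:
  "state_traj S x1 u q t - state_traj S x2 u q t = state_traj S (x1 - x2) (\<lambda>_. 0) q t"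
  by (induction t) (simp_all add: algebra_simps flip: matrix_vector_mult_diff_distrib)

lemma state_traj_shift:
  "state_traj S (mat_A S q' *v x) (\<lambda>_. 0) q t = state_traj S x (\<lambda>_. 0) (case_nat q' q) (Suc t)"
  by (induction t) simp_all

text \<open>The difference of two trajectories under the same input and switching evolves freely, so inputs
do not help to distinguish states.\<close>

lemma io_map_eq_iff:
  "io_map S x1 = io_map S x2 \<longleftrightarrow>
     (\<forall>q\<in>switching_seqs S. \<forall>t. output_traj S (x1 - x2) (\<lambda>_. 0) q t = 0)"
proof -
  have diff: "output_traj S x1 u q t = output_traj S x2 u q t \<longleftrightarrow>
      output_traj S (x1 - x2) (\<lambda>_. 0) q t = 0" for u q t
    unfolding output_traj_def state_traj_diff[of S x1 u q t x2, symmetric]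
    by (simp add: matrix_vector_mult_diff_distrib)
  have "io_map S x1 = io_map S x2 \<longleftrightarrow>
      (\<forall>u\<in>l2_inputs. \<forall>q\<in>switching_seqs S. \<forall>t. output_traj S x1 u q t = output_traj S x2 u q t)"
    unfolding io_map_def restrict_def by (auto simp: fun_eq_iff)
  then show ?thesis unfolding diff using zero_in_l2_inputs by blast
qed

text \<open>States with zero output form an invariant set because a first step in an arbitrary mode can be
prepended to any switching sequence.\<close>

lemma silent_iff_zero_output:
  "silent (modes S) (mat_A S) (mat_C S) x \<longleftrightarrow>
     (\<forall>q\<in>switching_seqs S. \<forall>t. output_traj S x (\<lambda>_. 0) q t = 0)"
proof
  assume "silent (modes S) (mat_A S) (mat_C S) x"
  then obtain N where N: "x \<in> N"
    "\<And>y q. \<lbrakk>y \<in> N; q \<in> modes S\<rbrakk> \<Longrightarrow> mat_C S q *v y = 0 \<and> mat_A S q *v y \<in> N"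
    unfolding silent_def by blast
  have "state_traj S x (\<lambda>_. 0) q t \<in> N" if "q \<in> switching_seqs S" for q t
    using that by (induction t) (auto simp: N switching_seqs_def)
  then show "\<forall>q\<in>switching_seqs S. \<forall>t. output_traj S x (\<lambda>_. 0) q t = 0"
    using N by (auto simp: output_traj_def switching_seqs_def)
next
  let ?N = "{x. \<forall>q\<in>switching_seqs S. \<forall>t. output_traj S x (\<lambda>_. 0) q t = 0}"
  assume "\<forall>q\<in>switching_seqs S. \<forall>t. output_traj S x (\<lambda>_. 0) q t = 0"
  moreover have "mat_C S q' *v y = 0" if "y \<in> ?N" "q' \<in> modes S" for y q'
  proof -
    have "(\<lambda>_. q') \<in> switching_seqs S" using that by (simp add: switching_seqs_def)
    then have "output_traj S y (\<lambda>_. 0) (\<lambda>_. q') 0 = 0" using that by blast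
    then show ?thesis by (simp add: output_traj_def)
  qed
  moreover have "mat_A S q' *v y \<in> ?N" if y: "y \<in> ?N" and q': "q' \<in> modes S" for y q'
  proof (intro CollectI ballI allI)
    fix q t assume "q \<in> switching_seqs S"
    then have "case_nat q' q \<in> switching_seqs S"
      using q' by (auto simp: switching_seqs_def split: nat.split)
    then have "output_traj S y (\<lambda>_. 0) (case_nat q' q) (Suc t) = 0" using y by blast
    then show "output_traj S (mat_A S q' *v y) (\<lambda>_. 0) q t = 0"
      unfolding output_traj_def state_traj_shift by simp
  qed
  ultimately show "silent (modes S) (mat_A S) (mat_C S) x"
    unfolding silent_def by (intro exI[of _ ?N]) blast
qed

lemma observable_iff:
  "observable S \<longleftrightarrow> (\<forall>x. silent (modes S) (mat_A S) (mat_C S) x \<longrightarrow> x = 0)"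
  unfolding observable_def io_map_eq_iff silent_iff_zero_output
  by (metis diff_zero right_minus_eq)

abbreviation reachable :: "('n::finite, 'm::finite, 'p::finite) lss \<Rightarrow> (real^'n) set" where
  "reachable S \<equiv> {state_traj S 0 u q t | u q t. u \<in> l2_inputs \<and> q \<in> switching_seqs S}"

lemma state_traj_cong:
  "(\<And>s. s < t \<Longrightarrow> u s = u' s \<and> q s = q' s) \<Longrightarrow> state_traj S x u q t = state_traj S x u' q' t"
  by (induction t) auto

text \<open>The new mode and input value are written at time \<open>t\<close>; cutting the input off after \<open>t\<close> keeps it
square-summable.\<close>

lemma reachable_step:
  assumes "y \<in> reachable S" "q' \<in> modes S"
  shows "mat_A S q' *v y + mat_B S q' *v w \<in> reachable S"
proof -
  obtain u q t where y: "y = state_traj S 0 u q t" "q \<in> switching_seqs S"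
    using assms by blast
  define u1 where "u1 = (\<lambda>s. if s < t then u s else if s = t then w else 0)"
  define q1 where "q1 = (\<lambda>s. if s = t then q' else q s)"
  have "summable (\<lambda>s. (norm (u1 s))\<^sup>2)"
    by (rule summable_finite[of "{..t}"]) (auto simp: u1_def)
  then have "u1 \<in> l2_inputs" by (simp add: l2_inputs_def)
  moreover have "q1 \<in> switching_seqs S"
    using y assms by (simp add: q1_def switching_seqs_def)
  moreover have "state_traj S 0 u1 q1 t = y"
    unfolding y by (rule state_traj_cong) (auto simp: u1_def q1_def)
  then have "state_traj S 0 u1 q1 (Suc t) = mat_A S q' *v y + mat_B S q' *v w"
    by (simp add: u1_def q1_def)
  ultimately show ?thesis by (metis (mono_tags, lifting) mem_Collect_eq)
qed

lemma zero_reachable: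
  assumes "modes S \<noteq> {}"
  shows "0 \<in> reachable S"
proof -
  obtain q where "q \<in> modes S" using assms by blast
  then have "(\<lambda>_. q) \<in> switching_seqs S" by (simp add: switching_seqs_def)
  moreover have "0 = state_traj S 0 (\<lambda>_. 0) (\<lambda>_. q) 0" by simp
  ultimately show ?thesis using zero_in_l2_inputs by blast
qed

text \<open>The orthogonal complement of a set closed under \<open>y \<mapsto> A q y + B q w\<close> and containing \<open>0\<close> is
invariant under \<open>A q\<^sup>T\<close> and killed by \<open>B q\<^sup>T\<close>; conversely a silent vector is moved backwards along
a trajectory until it meets the initial state \<open>0\<close>.\<close>

lemma silent_transpose_iff_orthogonal_reachable:
  assumes "modes S \<noteq> {}"
  shows "silent (modes S) (\<lambda>q. transpose (mat_A S q)) (\<lambda>q. transpose (mat_B S q)) x \<longleftrightarrow>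
     (\<forall>y\<in>reachable S. x \<bullet> y = 0)"
proof
  assume "silent (modes S) (\<lambda>q. transpose (mat_A S q)) (\<lambda>q. transpose (mat_B S q)) x"
  then obtain N where N: "x \<in> N"
    "\<And>y q. \<lbrakk>y \<in> N; q \<in> modes S\<rbrakk> \<Longrightarrow> transpose (mat_B S q) *v y = 0 \<and> transpose (mat_A S q) *v y \<in> N"
    unfolding silent_def by blast
  have "z \<bullet> state_traj S 0 u q t = 0" if "z \<in> N" "q \<in> switching_seqs S" for z u q t
    using that
  proof (induction t arbitrary: z)
    case (Suc t)
    then have "q t \<in> modes S" by (simp add: switching_seqs_def)
    then show ?case
      unfolding state_traj.simps inner_add_right inner_matrix_transpose
      using Suc N(2)[of z "q t"] by (simp del: transpose_matrix_vector)
  qed simp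
  then show "\<forall>y\<in>reachable S. x \<bullet> y = 0" using N(1) by blast
next
  let ?N = "{x. \<forall>y\<in>reachable S. x \<bullet> y = 0}"
  assume "\<forall>y\<in>reachable S. x \<bullet> y = 0"
  moreover have "transpose (mat_B S q) *v z = 0" if z: "z \<in> ?N" and q: "q \<in> modes S" for z q
  proof -
    let ?b = "transpose (mat_B S q) *v z"
    have "mat_A S q *v 0 + mat_B S q *v ?b \<in> reachable S"
      using reachable_step[OF zero_reachable[OF assms] q] .
    then have "z \<bullet> (mat_B S q *v ?b) = 0" using z by auto
    then have "?b \<bullet> ?b = 0" unfolding inner_matrix_transpose .
    then show ?thesis by simp
  qed
  moreover have "transpose (mat_A S q) *v z \<in> ?N" if z: "z \<in> ?N" and q: "q \<in> modes S" for z q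
  proof (intro CollectI ballI)
    fix y assume "y \<in> reachable S"
    then have "mat_A S q *v y + mat_B S q *v 0 \<in> reachable S" using q by (rule reachable_step)
    then have "z \<bullet> (mat_A S q *v y) = 0" using z by auto
    then show "(transpose (mat_A S q) *v z) \<bullet> y = 0" unfolding inner_matrix_transpose .
  qed
  ultimately show "silent (modes S) (\<lambda>q. transpose (mat_A S q)) (\<lambda>q. transpose (mat_B S q)) x"
    unfolding silent_def by (intro exI[of _ ?N]) blast
qed

lemma span_eq_UNIV_iff_orthogonal:
  fixes R :: "'a::euclidean_space set"
  shows "span R = UNIV \<longleftrightarrow> (\<forall>x. (\<forall>y\<in>R. x \<bullet> y = 0) \<longrightarrow> x = 0)"
proof
  assume *: "span R = UNIV"
  show "\<forall>x. (\<forall>y\<in>R. x \<bullet> y = 0) \<longrightarrow> x = 0"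
  proof (intro allI impI)
    fix x assume "\<forall>y\<in>R. x \<bullet> y = 0"
    then have "orthogonal x y" if "y \<in> span R" for y
      using that by (intro orthogonal_to_span[of y R]) (auto simp: orthogonal_def)
    then show "x = 0" using * orthogonal_self by blast
  qed
next
  assume *: "\<forall>x. (\<forall>y\<in>R. x \<bullet> y = 0) \<longrightarrow> x = 0"
  show "span R = UNIV"
  proof (rule ccontr)
    assume "span R \<noteq> UNIV"
    then have "span R \<subset> span UNIV" by auto
    then obtain x where "x \<noteq> 0" "\<And>y. y \<in> span R \<Longrightarrow> orthogonal x y"
      using orthogonal_to_subspace_exists_gen by metis
    then show False using * span_base by (metis orthogonal_def)
  qed
qed

lemma span_reachable_iff:
  assumes "modes S \<noteq> {}"
  shows "span_reachable S \<longleftrightarrow>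
     (\<forall>x. silent (modes S) (\<lambda>q. transpose (mat_A S q)) (\<lambda>q. transpose (mat_B S q)) x \<longrightarrow> x = 0)"
  unfolding span_reachable_def span_eq_UNIV_iff_orthogonal
    silent_transpose_iff_orthogonal_reachable[OF assms] ..

theorem lemma10:
  fixes S :: "('n::finite, 'm::finite, 'p::finite) lss"
  assumes "num_modes S \<ge> 1"
    and "strongly_stable S"
  shows "(span_reachable S \<longleftrightarrow> pos_def (ctrl_grammian S)) \<and>
         (observable S \<longleftrightarrow> pos_def (obs_grammian S))"
proof -
  have Q: "finite (modes S)" "modes S \<noteq> {}" using assms(1) by (auto simp: modes_def)
  have A: "lyapunov_stable (modes S) (mat_A S)"
    using assms(2) by (rule strongly_stable_imp_lyapunov_stable)
  have "ctrl_grammian S =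
      grammian (modes S) (\<lambda>q. transpose (mat_A S q)) (\<lambda>q. transpose (mat_B S q))"
    by (simp add: ctrl_grammian_def grammian_def lyapunov_def)
  moreover have "obs_grammian S = grammian (modes S) (mat_A S) (mat_C S)"
    by (simp add: obs_grammian_def grammian_def lyapunov_def)
  ultimately show ?thesis
    by (simp only: span_reachable_iff[OF Q(2)] observable_iff pos_def_grammian_iff[OF A Q(1)]
        pos_def_grammian_iff[OF lyapunov_stable_transpose[OF A] Q(1)])
qed

end
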